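(* Let $p$ and $m$ be positive integers. The automaton $\mathcal{M}_{m,\mathcal{T},2^p}$ (defined in the context) is the minimal automaton of the language $\mathrm{val}^{-1}_{2^p}(m\mathcal{T})$.
   Context: Numeration. $A_{2^p}=\{0,\dots,2^p-1\}$; for $w=c_{\ell-1}\cdots c_0\in A_{2^p}^*$, $\mathrm{val}_{2^p}(w)=\sum_{j}c_j2^{pj}$; for $Y\subseteq\mathbb{N}$, $\mathrm{val}_{2^p}^{-1}(Y)=\{w\in A_{2^p}^*:\mathrm{val}_{2^p}(w)\in Y\}$. $\mathcal{T}$ is the set of natural numbers whose base-$2$ expansion has an even number of digits $1$, and $m\mathcal{T}=\{mt:t\in\mathcal{T}\}$. $[\![a,b]\!]$ denotes the integer interval $\{a,\dots,b\}$ (empty if $b<a$). Two symbols $T,B$ are fixed, with $\overline T=B$, $\overline B=T$, and for $X\in\{T,B\}$, $n\in\mathbb{N}$: $X_n=X$ if $n\in\mathcal{T}$ and $X_n=\overline X$ otherwise. Write $m=k2^z$ with $k$ odd, $z\ge 0$. Projected automaton $\Pi(\mathcal{A}_{m,2^p}\times\mathcal{A}_{\mathcal{T},2^p})$. Its alphabet is $A_{2^p}$; its states are the pairs $(i,X)$ with $i\in[\![0,m-1]\!]$, $X\in\{T,B\}$; $(0,T)$ is the initial state and the unique final state; there is a transition labeled $e\in A_{2^p}$ from $(i,X)$ to $(j,Y)$ iff there exists $d\in A_{2^p}$ with $2^pi+e=md+j$ and $Y=X_d$. Classes. For $(j,X)\in([\![1,k-1]\!]\times\{T,B\})\cup\{(0,B)\}$,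 let $[(j,X)]=\{(j+k\ell,X_\ell):\ell\in[\![0,2^z-1]\!]\}$, and let $[(0,T)]=\{(0,T)\}$. For $\alpha\in[\![0,z-1]\!]$ let $C_\alpha=\{(k2^{z-\alpha-1}+k2^{z-\alpha}\ell,\,B_\ell):\ell\in[\![0,2^\alpha-1]\!]\}$. For $\beta\in[\![0,\lceil z/p\rceil-2]\!]$ let $\Gamma_\beta=\bigcup_{\alpha=\beta p}^{\beta p+p-1}C_\alpha$, and (if $z\ge1$) let $\Gamma_{\lceil z/p\rceil-1}=\bigcup_{\alpha=(\lceil z/p\rceil-1)p}^{z-1}C_\alpha$. The automaton $\mathcal{M}_{m,\mathcal{T},2^p}$. Its alphabet is $A_{2^p}$; its states are the classes $[(j,X)]$ for $(j,X)\in[\![0,k-1]\!]\times\{T,B\}$ and the classes $\Gamma_\beta$ for $\beta\in[\![0,\lceil z/p\rceil-1]\!]$; $[(0,T)]$ is the initial state and the only final state; there is a transition labeled $a\in A_{2^p}$ from a class $J_1$ to a class $J_2$ iff there exist states $j_1\in J_1$, $j_2\in J_2$ such that $\Pi(\mathcal{A}_{m,2^p}\times\mathcal{A}_{\mathcal{T},2^p})$ has a transition labeled $a$ from $j_1$ to $j_2$. The minimal automaton of a regular language is its complete deterministic automaton (unique up to isomorphism) that is accessible (every state is reachable from the initial state) and reduced (distinct states accept distinct languages). *)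

theory Defs
  imports Complex_Main "HOL-Computational_Algebra.Primes"
begin

record ('q, 'a) automaton =
  alphabet :: "'a set"
  states :: "'q set"
  init :: 'q
  finals :: "'q set"
  trans :: "('q \<times> 'a \<times> 'q) set"

definition wf_automaton :: "('q, 'a) automaton \<Rightarrow> bool" where
  "wf_automaton A \<longleftrightarrow>
     finite (alphabet A) \<and> finite (states A) \<and> init A \<in> states A \<and>
     finals A \<subseteq> states A \<and> trans A \<subseteq> states A \<times> alphabet A \<times> states A"

primrec run :: "('q, 'a) automaton \<Rightarrow> 'q \<Rightarrow> 'a list \<Rightarrow> 'q \<Rightarrow> bool" where
  "run A q [] r \<longleftrightarrow> r = q"
| "run A q (a # w) r \<longleftrightarrow> (\<exists>s. (q, a, s) \<in> trans A \<and> run A s w r)"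

definition lang_from :: "('q, 'a) automaton \<Rightarrow> 'q \<Rightarrow> 'a list set" where
  "lang_from A q = {w \<in> lists (alphabet A). \<exists>f\<in>finals A. run A q w f}"

definition language :: "('q, 'a) automaton \<Rightarrow> 'a list set" where
  "language A = lang_from A (init A)"

definition deterministic :: "('q, 'a) automaton \<Rightarrow> bool" where
  "deterministic A \<longleftrightarrow>
     (\<forall>q a r s. (q, a, r) \<in> trans A \<longrightarrow> (q, a, s) \<in> trans A \<longrightarrow> r = s)"

definition complete_automaton :: "('q, 'a) automaton \<Rightarrow> bool" where
  "complete_automaton A \<longleftrightarrow>
     (\<forall>q\<in>states A. \<forall>a\<in>alphabet A. \<exists>r\<in>states A. (q, a, r) \<in> trans A)"

definition accessible :: "('q, 'a) automaton \<Rightarrow> bool" where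
  "accessible A \<longleftrightarrow> (\<forall>q\<in>states A. \<exists>w\<in>lists (alphabet A). run A (init A) w q)"

definition reduced :: "('q, 'a) automaton \<Rightarrow> bool" where
  "reduced A \<longleftrightarrow>
     (\<forall>q\<in>states A. \<forall>r\<in>states A. q \<noteq> r \<longrightarrow> lang_from A q \<noteq> lang_from A r)"

text \<open>The minimal automaton depends on the alphabet \<open>\<Sigma>\<close> over which the language is considered.
  It is unique up to isomorphism, so being minimal is a property of an automaton.\<close>

definition is_minimal_automaton ::
    "'a set \<Rightarrow> 'a list set \<Rightarrow> ('q, 'a) automaton \<Rightarrow> bool" where
  "is_minimal_automaton \<Sigma> L A \<longleftrightarrow>
     wf_automaton A \<and> alphabet A = \<Sigma> \<and> language A = L \<and>
     deterministic A \<and> complete_automaton A \<and> accessible A \<and> reduced A"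

definition digits :: "nat \<Rightarrow> nat set" where
  "digits p = {0..<2 ^ p}"

text \<open>Words are written with the most significant digit first, hence \<^const>\<open>rev\<close>.\<close>

definition val :: "nat \<Rightarrow> nat list \<Rightarrow> nat" where
  "val p w = (\<Sum>j<length w. rev w ! j * 2 ^ (p * j))"

definition val_inv :: "nat \<Rightarrow> nat set \<Rightarrow> nat list set" where
  "val_inv p Y = {w \<in> lists (digits p). val p w \<in> Y}"

definition thue_morse :: "nat set" where
  "thue_morse = {n. even (card {i. bit n i})}"

datatype side = T | B

fun opp :: "side \<Rightarrow> side" where
  "opp T = B"
| "opp B = T"

text \<open>\<open>twist X n\<close> is \<open>X\<^sub>n\<close>.\<close>

definition twist :: "side \<Rightarrow> nat \<Rightarrow> side" where
  "twist X n = (if n \<in> thue_morse then X else opp X)"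

definition projected_automaton :: "nat \<Rightarrow> nat \<Rightarrow> (nat \<times> side, nat) automaton" where
  "projected_automaton m p =
     \<lparr> alphabet = digits p,
       states = {0..<m} \<times> UNIV,
       init = (0, T),
       finals = {(0, T)},
       trans = {((i, X), e, (j, Y)) | i X e j Y.
                  i < m \<and> j < m \<and> e \<in> digits p \<and>
                  (\<exists>d\<in>digits p. 2 ^ p * i + e = m * d + j \<and> Y = twist X d)} \<rparr>"

definition two_exp :: "nat \<Rightarrow> nat" where
  "two_exp m = multiplicity 2 m"

definition odd_part :: "nat \<Rightarrow> nat" where
  "odd_part m = m div 2 ^ two_exp m"

lemma odd_part_two_exp: "m = odd_part m * 2 ^ two_exp m"
  by (simp add: odd_part_def two_exp_def multiplicity_dvd)

lemma odd_odd_part: "m > 0 \<Longrightarrow> odd (odd_part m)"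
  using multiplicity_decompose[of m 2] by (simp add: odd_part_def two_exp_def)

definition pair_class :: "nat \<Rightarrow> nat \<Rightarrow> nat \<times> side \<Rightarrow> (nat \<times> side) set" where
  "pair_class k z = (\<lambda>(j, X).
     if (j, X) = (0, T) then {(0, T)}
     else {(j + k * l, twist X l) | l. l < 2 ^ z})"

text \<open>The natural-number subtractions in the exponents are exact for \<open>\<alpha> < z\<close>, the only case used.\<close>

definition C_class :: "nat \<Rightarrow> nat \<Rightarrow> nat \<Rightarrow> (nat \<times> side) set" where
  "C_class k z \<alpha> =
     {(k * 2 ^ (z - \<alpha> - 1) + k * 2 ^ (z - \<alpha>) * l, twist B l) | l. l < 2 ^ \<alpha>}"

definition num_Gamma :: "nat \<Rightarrow> nat \<Rightarrow> nat" where
  "num_Gamma z p = nat \<lceil>real z / real p\<rceil>"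

text \<open>The last class, with index \<open>num_Gamma z p - 1\<close>, may collect fewer than \<open>p\<close> of the
  sets \<open>C_class k z \<alpha>\<close>.\<close>

definition Gamma_class :: "nat \<Rightarrow> nat \<Rightarrow> nat \<Rightarrow> nat \<Rightarrow> (nat \<times> side) set" where
  "Gamma_class k z p \<beta> =
     (if \<beta> + 1 < num_Gamma z p then (\<Union>\<alpha>\<in>{\<beta> * p..<\<beta> * p + p}. C_class k z \<alpha>)
      else (\<Union>\<alpha>\<in>{\<beta> * p..<z}. C_class k z \<alpha>))"

definition M_states :: "nat \<Rightarrow> nat \<Rightarrow> (nat \<times> side) set set" where
  "M_states m p =
     (let k = odd_part m; z = two_exp m in
       pair_class k z ` ({0..<k} \<times> UNIV) \<union> Gamma_class k z p ` {0..<num_Gamma z p})"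

definition M_automaton :: "nat \<Rightarrow> nat \<Rightarrow> ((nat \<times> side) set, nat) automaton" where
  "M_automaton m p =
     (let q\<^sub>0 = pair_class (odd_part m) (two_exp m) (0, T) in
      \<lparr> alphabet = digits p,
        states = M_states m p,
        init = q\<^sub>0,
        finals = {q\<^sub>0},
        trans = {(J\<^sub>1, a, J\<^sub>2) | J\<^sub>1 a J\<^sub>2.
                   J\<^sub>1 \<in> M_states m p \<and> J\<^sub>2 \<in> M_states m p \<and> a \<in> digits p \<and>
                   (\<exists>j\<^sub>1\<in>J\<^sub>1. \<exists>j\<^sub>2\<in>J\<^sub>2. (j\<^sub>1, a, j\<^sub>2) \<in> trans (projected_automaton m p))} \<rparr>)"

end

theory Submission
  imports Defs
begin

text \<open>Reading a word of length \<open>n\<close> and value \<open>v\<close> from the state \<open>(i, X)\<close> of the projected automaton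
  amounts to the Euclidean division of \<open>2\<^bsup>pn\<^esup> i + v\<close> by \<open>m\<close>, the quotient \<open>d\<close> acting on \<open>X\<close> by
  \<open>twist\<close>. Write a state as \<open>(j + k l, Y\<^sub>l)\<close> with \<open>j < k\<close> and \<open>l < 2\<^sup>z\<close>. If \<open>p n \<ge> z\<close>, the binary digits
  of \<open>l\<close> occur as a prefix of those of \<open>d\<close> and cancel the twist, so that acceptance depends on \<open>(j, Y)\<close>
  only; moreover, distinct pairs \<open>(j, Y)\<close> accept disjoint sets of words of length \<open>n\<close>, nonempty for
  large \<open>n\<close>. If \<open>p n < z\<close>, at most the word \<open>0\<^sup>n\<close> is accepted, and it is so iff \<open>(j, Y) = (0, T)\<close> and
  \<open>2\<^bsup>z-pn\<^esup>\<close> divides \<open>l\<close>. Hence the given classes are precisely the Nerode classes of the projected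
  automaton, which is accessible, deterministic and complete.\<close>

section \<open>Quotients of deterministic automata\<close>

lemma lang_from_trans:
  assumes "wf_automaton A" "deterministic A" "(q, a, s) \<in> trans A"
  shows "lang_from A s = {w. a # w \<in> lang_from A q}"
proof -
  have "a \<in> alphabet A"
    using assms(1,3) by (auto simp: wf_automaton_def)
  moreover have "run A q (a # w) f \<longleftrightarrow> run A s w f" for w f
    using assms(2,3) by (auto simp: deterministic_def)
  ultimately show ?thesis
    by (auto simp: lang_from_def simp del: run.simps)
qed

lemma Nil_in_lang_from: "[] \<in> lang_from A q \<longleftrightarrow> q \<in> finals A"
  by (auto simp: lang_from_def)

text \<open>The language of a state determines the languages of its successors, so language equality
  is a congruence, and \<open>nerode\<close> says that \<open>\<P>\<close> consists of its classes.
  The existential transitions of \<open>Q\<close> therefore form the quotient automaton.\<close>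

lemma quotient_is_minimal:
  assumes A: "wf_automaton A" "deterministic A" "complete_automaton A" "accessible A"
    and cover: "\<Union>\<P> = states A" and nonempty: "{} \<notin> \<P>"
    and nerode: "\<And>J K q r. J \<in> \<P> \<Longrightarrow> K \<in> \<P> \<Longrightarrow> q \<in> J \<Longrightarrow> r \<in> K \<Longrightarrow>
                   J = K \<longleftrightarrow> lang_from A q = lang_from A r"
    and alphabet: "alphabet Q = alphabet A" and states: "states Q = \<P>"
    and init: "init Q \<in> \<P>" "init A \<in> init Q"
    and finals: "finals Q = {J \<in> \<P>. J \<inter> finals A \<noteq> {}}"
    and trans: "trans Q = {(J, a, K) | J a K. J \<in> \<P> \<and> K \<in> \<P> \<and> a \<in> alphabet A \<and>
                   (\<exists>q\<in>J. \<exists>r\<in>K. (q, a, r) \<in> trans A)}"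
  shows "is_minimal_automaton (alphabet A) (language A) Q"
proof -
  have "\<P> \<subseteq> Pow (states A)"
    using cover by blast
  then have "finite \<P>"
    using A(1) by (meson finite_Pow_iff finite_subset wf_automaton_def)
  then have wf: "wf_automaton Q"
    using A(1) init unfolding wf_automaton_def alphabet states finals trans by auto
  have det: "deterministic Q"
    unfolding deterministic_def
  proof (intro allI impI)
    fix J a K K' assume "(J, a, K) \<in> trans Q" "(J, a, K') \<in> trans Q"
    then obtain q r q' r' where J: "J \<in> \<P>" "K \<in> \<P>" "K' \<in> \<P>"
      and q: "q \<in> J" "r \<in> K" "(q, a, r) \<in> trans A"
      and q': "q' \<in> J" "r' \<in> K'" "(q', a, r') \<in> trans A"
      unfolding trans by blast
    have "lang_from A q = lang_from A q'"
      using nerode[OF J(1,1) q(1) q'(1)] by simp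
    then have "lang_from A r = lang_from A r'"
      using lang_from_trans[OF A(1,2)] q(3) q'(3) by simp
    then show "K = K'"
      using nerode[OF J(2,3) q(2) q'(2)] by simp
  qed
  have step: "\<exists>K\<in>\<P>. r \<in> K \<and> (J, a, K) \<in> trans Q"
    if "J \<in> \<P>" "q \<in> J" "(q, a, r) \<in> trans A" for J q a r
  proof -
    have r: "r \<in> states A" "a \<in> alphabet A"
      using A(1) that(3) by (auto simp: wf_automaton_def)
    then obtain K where "K \<in> \<P>" "r \<in> K"
      using cover by blast
    then show ?thesis
      using that r unfolding trans by blast
  qed
  have complete: "complete_automaton Q"
    unfolding complete_automaton_def alphabet states
  proof (intro ballI)
    fix J a assume J: "J \<in> \<P>" "a \<in> alphabet A"
    then obtain q where q: "q \<in> J" "q \<in> states A"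
      using nonempty cover by (metis UnionI all_not_in_conv)
    then obtain r where "(q, a, r) \<in> trans A"
      using A(3) J(2) by (meson complete_automaton_def)
    then show "\<exists>K\<in>\<P>. (J, a, K) \<in> trans Q"
      using step J q by blast
  qed
  have run_quotient: "\<exists>K\<in>\<P>. r \<in> K \<and> run Q J w K"
    if "J \<in> \<P>" "q \<in> J" "run A q w r" for J q w r
    using that
  proof (induction w arbitrary: J q)
    case (Cons a w)
    then obtain s where s: "(q, a, s) \<in> trans A" "run A s w r"
      by auto
    then obtain J' where "J' \<in> \<P>" "s \<in> J'" "(J, a, J') \<in> trans Q"
      using step Cons.prems by blast
    then show ?case
      using Cons.IH s(2) by (meson run.simps(2))
  qed auto
  have acc: "accessible Q"
    unfolding accessible_def states alphabet
  proof
    fix J assume J: "J \<in> \<P>"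
    then obtain q where q: "q \<in> J" "q \<in> states A"
      using nonempty cover by (metis UnionI all_not_in_conv)
    then obtain w where w: "w \<in> lists (alphabet A)" "run A (init A) w q"
      using A(4) by (auto simp: accessible_def)
    then obtain K where K: "K \<in> \<P>" "q \<in> K" "run Q (init Q) w K"
      using run_quotient init by blast
    \<comment> \<open>The state \<open>q\<close> lies in both classes, so \<open>nerode\<close> with
      \<open>q\<close> on both sides identifies them.\<close>
    then have "K = J"
      using nerode[OF K(1) J K(2) q(1)] by simp
    then show "\<exists>w\<in>lists (alphabet A). run Q (init Q) w J"
      using w(1) K(3) by blast
  qed
  have final_iff: "J \<in> finals Q \<longleftrightarrow> q \<in> finals A" if "J \<in> \<P>" "q \<in> J" for J q
  proof -
    \<comment> \<open>Being final means accepting the empty word, hence is constant on a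
      class.\<close>
    have "r \<in> finals A \<longleftrightarrow> q \<in> finals A" if "r \<in> J" for r
      using nerode[OF \<open>J \<in> \<P>\<close> \<open>J \<in> \<P>\<close> \<open>q \<in> J\<close> that] Nil_in_lang_from by metis
    then show ?thesis
      using that unfolding finals by blast
  qed
  have lang_iff: "w \<in> lang_from Q J \<longleftrightarrow> w \<in> lang_from A q" if "J \<in> \<P>" "q \<in> J" for w J q
    using that
  proof (induction w arbitrary: J q)
    case Nil
    then show ?case
      by (simp add: Nil_in_lang_from final_iff)
  next
    case (Cons a w)
    show ?case
    proof (cases "a \<in> alphabet A")
      case True
      moreover have "q \<in> states A"
        using Cons.prems cover by blast
      ultimately obtain r where r: "(q, a, r) \<in> trans A"
        using A(3) by (meson complete_automaton_def)
      then obtain K where K: "K \<in> \<P>" "r \<in> K" "(J, a, K) \<in> trans Q"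
        using step Cons.prems by blast
      show ?thesis
        using Cons.IH[OF K(1,2)] lang_from_trans[OF A(1,2) r] lang_from_trans[OF wf det K(3)]
        by simp
    next
      case False
      then show ?thesis
        by (simp add: lang_from_def alphabet)
    qed
  qed
  have reduced: "reduced Q"
    unfolding reduced_def states
  proof (intro ballI impI)
    fix J K assume JK: "J \<in> \<P>" "K \<in> \<P>" "J \<noteq> K"
    then obtain q r where "q \<in> J" "r \<in> K"
      using nonempty by (metis all_not_in_conv)
    then show "lang_from Q J \<noteq> lang_from Q K"
      using nerode[of J K q r] lang_iff JK by blast
  qed
  have "language Q = language A"
    using lang_iff init by (auto simp: language_def)
  then show ?thesis
    using wf det complete acc reduced alphabet by (simp add: is_minimal_automaton_def)
qed


section \<open>The Thue--Morse set\<close>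

lemma finite_bits: "finite {i. bit (n::nat) i}"
proof (rule finite_subset)
  show "{i. bit n i} \<subseteq> {..n}"
  proof safe
    fix i assume "bit n i"
    then have "2 ^ i \<le> n"
      by (metis bit_nat_def div_less even_zero not_less)
    then show "i \<le> n"
      using less_exp[of i] by linarith
  qed
qed simp

text \<open>The digits 1 of \<open>n\<close> are those of \<open>n div 2\<close> moved up one place,
  together with the lowest digit when \<open>n\<close> is odd.\<close>

lemma thue_morse_rec: "n \<in> thue_morse \<longleftrightarrow> (even n \<longleftrightarrow> n div 2 \<in> thue_morse)"
proof -
  have eq: "{i. bit n i} = (if odd n then {0} else {}) \<union> Suc ` {i. bit (n div 2) i}"
  proof (rule set_eqI)
    fix i show "i \<in> {i. bit n i} \<longleftrightarrow> i \<in> (if odd n then {0} else {}) \<union> Suc ` {i. bit (n div 2) i}"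
      by (cases i) (auto simp: bit_0 bit_Suc)
  qed
  have "card {i. bit n i} = (if odd n then 1 else 0) + card {i. bit (n div 2) i}"
    unfolding eq by (subst card_Un_disjoint) (auto simp: finite_bits card_image)
  then show ?thesis
    by (auto simp: thue_morse_def)
qed

lemma zero_in_thue_morse [simp]: "0 \<in> thue_morse"
  by (simp add: thue_morse_def bot_fun_def)

text \<open>The expansion of the sum is that of \<open>a\<close> followed by the \<open>N\<close>
  digits of \<open>b\<close>, so the numbers of digits 1 add up.\<close>

lemma thue_morse_concat:
  "b < 2 ^ N \<Longrightarrow> 2 ^ N * a + b \<in> thue_morse \<longleftrightarrow> (a \<in> thue_morse \<longleftrightarrow> b \<in> thue_morse)"
proof (induction N arbitrary: b)
  case (Suc N)
  have "(2 ^ Suc N * a + b) div 2 = 2 ^ N * a + b div 2"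
    by simp
  moreover have "b div 2 < 2 ^ N"
    using Suc.prems by auto
  ultimately show ?case
    using Suc.IH[of "b div 2"] thue_morse_rec[of "2 ^ Suc N * a + b"] thue_morse_rec[of b]
    by auto
qed simp

lemma opp_opp [simp]: "opp (opp X) = X"
  by (cases X) auto

lemma twist_0 [simp]: "twist X 0 = X"
  by (simp add: twist_def)

lemma twist_1 [simp]: "twist X (Suc 0) = opp X"
  using thue_morse_rec[of 1] by (simp add: twist_def)

lemma twist_twist_same [simp]: "twist (twist X n) n = X"
  by (simp add: twist_def)

lemma twist_inject [simp]: "twist X n = twist Y n \<longleftrightarrow> X = Y"
  by (metis twist_twist_same)

lemma twist_concat: "b < 2 ^ N \<Longrightarrow> twist (twist X a) b = twist X (2 ^ N * a + b)"
  by (simp add: twist_def thue_morse_concat)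

text \<open>The prefix \<open>a\<close> undoes the initial twist by \<open>a\<close>. This is what
  makes the states \<open>j + k * l\<close> with different \<open>l\<close> agree on long
  words.\<close>

lemma twist_cancel: "b < 2 ^ N \<Longrightarrow> twist (twist X a) (2 ^ N * a + b) = twist X b"
  by (simp flip: twist_concat)

lemma twist_shift: "twist X (2 ^ N * a) = twist X a"
  using twist_concat[of 0 N X a] by simp

lemma twist_T_odd: "twist T (2 * a + 1) = twist B a"
  using thue_morse_rec[of "2 * a + 1"] by (simp add: twist_def)

text \<open>The two numbers differ only in their last digit, so their parities of digits 1 are
  opposite.\<close>

lemma twist_both: "\<exists>d \<in> {2 * a, 2 * a + 1}. twist X d = Y"
  using twist_concat[of 0 1 X a] twist_concat[of 1 1 X a]
  by (cases "twist X a"; cases Y) auto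


section \<open>The projected automaton\<close>

lemma val_Nil [simp]: "val p [] = 0"
  by (simp add: val_def)

lemma val_Cons: "val p (a # w) = 2 ^ (p * length w) * a + val p w"
proof -
  have "(\<Sum>j<length w. (rev w @ [a]) ! j * 2 ^ (p * j)) = (\<Sum>j<length w. rev w ! j * 2 ^ (p * j))"
    by (intro sum.cong) (auto simp: nth_append)
  then show ?thesis
    by (simp add: val_def nth_append)
qed

lemma val_less: "w \<in> lists (digits p) \<Longrightarrow> val p w < 2 ^ (p * length w)"
proof (induction w)
  case (Cons a w)
  then have "Suc a \<le> 2 ^ p" "val p w < 2 ^ (p * length w)"
    by (auto simp: digits_def)
  then have "val p (a # w) < 2 ^ (p * length w) * Suc a"
    by (simp add: val_Cons)
  also have "\<dots> \<le> 2 ^ (p * length w) * 2 ^ p"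
    using \<open>Suc a \<le> 2 ^ p\<close> by (intro mult_le_mono2)
  finally show ?case
    by (simp add: power_add mult.commute)
qed simp

text \<open>Leading zeros are allowed, so the length can be prescribed. Languages can then be
  compared through pairs of length and value.\<close>

lemma ex_word:
  assumes "v < 2 ^ (p * n)"
  shows "\<exists>w\<in>lists (digits p). length w = n \<and> val p w = v"
  using assms
proof (induction n arbitrary: v)
  case (Suc n)
  obtain w where w: "w \<in> lists (digits p)" "length w = n" "val p w = v mod 2 ^ (p * n)"
    using Suc.IH[of "v mod 2 ^ (p * n)"] by auto
  moreover have "v div 2 ^ (p * n) < 2 ^ p"
    using Suc.prems by (simp add: less_mult_imp_div_less power_add)
  ultimately show ?case
    by (intro bexI[of _ "v div 2 ^ (p * n) # w"]) (auto simp: val_Cons digits_def)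
qed simp

text \<open>Uniqueness of Euclidean division. The quotient is automatically a digit, because
  \<open>i < m\<close> and \<open>e < 2 ^ p\<close> give
  \<open>2 ^ p * i + e < 2 ^ p * m\<close>.\<close>

lemma projected_trans_iff:
  assumes "m > 0"
  shows "((i, X), e, (j, Y)) \<in> trans (projected_automaton m p) \<longleftrightarrow>
    i < m \<and> e \<in> digits p \<and> j = (2 ^ p * i + e) mod m \<and> Y = twist X ((2 ^ p * i + e) div m)"
    (is "?L \<longleftrightarrow> ?R")
proof
  assume ?L
  then show ?R
    using assms by (auto simp: projected_automaton_def)
next
  assume R: ?R
  then have "2 ^ p * i + e < 2 ^ p * Suc i"
    by (simp add: digits_def)
  also have "\<dots> \<le> 2 ^ p * m"
    using R by (intro mult_le_mono2) simp
  finally have "(2 ^ p * i + e) div m \<in> digits p"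
    using assms by (simp add: digits_def less_mult_imp_div_less)
  then show ?L
    using R assms by (auto simp: projected_automaton_def intro!: bexI)
qed

lemma alphabet_projected [simp]: "alphabet (projected_automaton m p) = digits p"
  and states_projected [simp]: "states (projected_automaton m p) = {0..<m} \<times> UNIV"
  and init_projected [simp]: "init (projected_automaton m p) = (0, T)"
  and finals_projected [simp]: "finals (projected_automaton m p) = {(0, T)}"
  by (simp_all add: projected_automaton_def)

lemma UNIV_side: "UNIV = {T, B}"
  using side.exhaust by auto

lemma wf_projected: "m > 0 \<Longrightarrow> wf_automaton (projected_automaton m p)"
  unfolding wf_automaton_def
  by (simp add: UNIV_side digits_def) (auto simp: projected_automaton_def digits_def UNIV_side[symmetric])

lemma deterministic_projected: "m > 0 \<Longrightarrow> deterministic (projected_automaton m p)"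
  by (auto simp: deterministic_def projected_trans_iff)

lemma complete_projected: "m > 0 \<Longrightarrow> complete_automaton (projected_automaton m p)"
  by (auto simp: complete_automaton_def projected_trans_iff)

text \<open>Long division: the first letter yields a quotient \<open>d\<close> and a remainder
  \<open>s\<close>, and the other letters continue from \<open>s\<close>.\<close>

lemma run_projected_iff:
  assumes "m > 0" "i < m" "w \<in> lists (digits p)"
  shows "run (projected_automaton m p) (i, X) w (j, Y) \<longleftrightarrow>
    j = (2 ^ (p * length w) * i + val p w) mod m \<and>
    Y = twist X ((2 ^ (p * length w) * i + val p w) div m)"
  using assms(2,3)
proof (induction w arbitrary: i X)
  case (Cons a w)
  define N where "N = p * length w"
  define d where "d = (2 ^ p * i + a) div m"
  define s where "s = (2 ^ p * i + a) mod m"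
  define c where "c = 2 ^ N * s + val p w"
  have s: "s < m" and ds: "2 ^ p * i + a = m * d + s"
    using assms(1) by (auto simp: s_def d_def)
  \<comment> \<open>This bound lets \<open>c div m\<close> fit into \<open>N\<close> bits, so that
    the twists by \<open>d\<close> and by \<open>c div m\<close> merge through
    \<open>twist_concat\<close>.\<close>
  have "c < 2 ^ N * Suc s"
    using val_less[of w p] Cons.prems by (simp add: c_def N_def)
  also have "\<dots> \<le> 2 ^ N * m"
    using s by (intro mult_le_mono2) simp
  finally have c: "c div m < 2 ^ N"
    by (simp add: less_mult_imp_div_less)
  have "2 ^ (p * length (a # w)) * i + val p (a # w) = 2 ^ N * (2 ^ p * i + a) + val p w"
    by (simp add: val_Cons N_def power_add algebra_simps)
  also have "\<dots> = m * (2 ^ N * d) + c"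
    unfolding ds c_def by (simp add: algebra_simps)
  finally have V: "2 ^ (p * length (a # w)) * i + val p (a # w) = m * (2 ^ N * d) + c" .
  have "run (projected_automaton m p) (i, X) (a # w) (j, Y) \<longleftrightarrow>
      run (projected_automaton m p) (s, twist X d) w (j, Y)"
    using Cons.prems assms(1) by (auto simp: projected_trans_iff s_def d_def)
  also have "\<dots> \<longleftrightarrow> j = c mod m \<and> Y = twist (twist X d) (c div m)"
    using Cons.IH[OF s] Cons.prems by (simp add: c_def N_def)
  finally show ?case
    unfolding V using c assms(1) by (simp add: twist_concat)
qed auto

lemma accessible_projected:
  assumes "m > 0" "p > 0"
  shows "accessible (projected_automaton m p)"
  unfolding accessible_def
proof
  fix q assume "q \<in> states (projected_automaton m p)"
  then obtain i X where q: "q = (i, X)" "i < m"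
    by auto
  \<comment> \<open>A word of value \<open>m * d + i\<close> leads from \<open>(0, T)\<close> to
    \<open>(i, twist T d)\<close>; \<open>m * d + i\<close> letters suffice for it because
    \<open>n < 2 ^ n\<close>.\<close>
  obtain d where "twist T d = X"
    using twist_both by blast
  moreover have "(2::nat) ^ (m * d + i) \<le> 2 ^ (p * (m * d + i))"
    using assms(2) by (intro power_increasing) auto
  then obtain w where "w \<in> lists (digits p)" "val p w = m * d + i"
    using ex_word[of "m * d + i"] less_le_trans[OF less_exp] by blast
  ultimately show "\<exists>w\<in>lists (alphabet (projected_automaton m p)).
      run (projected_automaton m p) (init (projected_automaton m p)) w q"
    using q assms(1) by (intro bexI[of _ w]) (auto simp: run_projected_iff)
qed

section \<open>Acceptance as divisibility by the modulus\<close>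

text \<open>Only the number \<open>N\<close> of bits and the value \<open>v\<close> of a word enter;
  \<open>N\<close> need not be a multiple of \<open>p\<close>.\<close>

definition accepts :: "nat \<Rightarrow> nat \<Rightarrow> side \<Rightarrow> nat \<Rightarrow> nat \<Rightarrow> bool" where
  "accepts m i X N v \<longleftrightarrow> (\<exists>d. 2 ^ N * i + v = m * d \<and> twist X d = T)"

lemma lang_from_projected:
  assumes "m > 0" "i < m"
  shows "lang_from (projected_automaton m p) (i, X) =
    {w \<in> lists (digits p). accepts m i X (p * length w) (val p w)}"
proof -
  have "0 = V mod m \<and> T = twist X (V div m) \<longleftrightarrow> (\<exists>d. V = m * d \<and> twist X d = T)" for V
    using assms(1) by auto
  then have "run (projected_automaton m p) (i, X) w (0, T) \<longleftrightarrow> accepts m i X (p * length w) (val p w)"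
    if "w \<in> lists (digits p)" for w
    using run_projected_iff[OF assms that] by (simp add: accepts_def)
  then show ?thesis
    unfolding lang_from_def by auto
qed

lemma language_projected:
  assumes "m > 0"
  shows "language (projected_automaton m p) = val_inv p ((*) m ` thue_morse)"
proof -
  have "twist T d = T \<longleftrightarrow> d \<in> thue_morse" for d
    by (simp add: twist_def)
  then show ?thesis
    using assms by (auto simp: language_def lang_from_projected accepts_def val_inv_def)
qed

lemma lang_from_projected_eq_iff:
  assumes "m > 0" "i < m" "i' < m"
  shows "lang_from (projected_automaton m p) (i, X) = lang_from (projected_automaton m p) (i', X') \<longleftrightarrow>
    (\<forall>n v. v < 2 ^ (p * n) \<longrightarrow> accepts m i X (p * n) v \<longleftrightarrow> accepts m i' X' (p * n) v)"
    (is "?L \<longleftrightarrow> ?R")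
proof
  assume ?L
  show ?R
  proof (intro allI impI)
    fix n v :: nat assume "v < 2 ^ (p * n)"
    then obtain w where "w \<in> lists (digits p)" "length w = n" "val p w = v"
      using ex_word by blast
    then show "accepts m i X (p * n) v \<longleftrightarrow> accepts m i' X' (p * n) v"
      using \<open>?L\<close> assms by (auto simp: lang_from_projected)
  qed
next
  assume ?R
  then show ?L
    using assms val_less by (auto simp: lang_from_projected)
qed

section \<open>Nerode classes of the projected automaton\<close>

text \<open>With \<open>m = k * 2 ^ z\<close>, \<open>2 ^ N * k = m * 2 ^ (N - z)\<close>, so adding
  \<open>k * l\<close> to the state adds \<open>2 ^ (N - z) * l\<close> to the quotient. The
  quotient for \<open>j\<close> is below \<open>2 ^ (N - z)\<close>, so \<open>l\<close> is a binary
  prefix and \<open>twist_cancel\<close> applies.\<close>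

lemma accepts_long:
  assumes "0 < k" "j < k" "v < 2 ^ N" "z \<le> N"
  shows "accepts (k * 2 ^ z) (j + k * l) (twist Y l) N v \<longleftrightarrow> accepts (k * 2 ^ z) j Y N v"
proof -
  define m where "m = k * 2 ^ z"
  have m: "m > 0" and Nk: "2 ^ N * k = m * 2 ^ (N - z)"
    using assms by (simp_all add: m_def flip: power_add)
  have shift: "2 ^ N * (j + k * l) + v = m * (2 ^ (N - z) * l) + (2 ^ N * j + v)"
    using Nk by (simp add: algebra_simps)
  have "2 ^ N * j + v < 2 ^ N * Suc j"
    using assms by simp
  also have "\<dots> \<le> 2 ^ N * k"
    using assms by (intro mult_le_mono2) simp
  finally have small: "2 ^ N * j + v < m * 2 ^ (N - z)"
    by (simp add: Nk)
  have "(\<exists>d. 2 ^ N * (j + k * l) + v = m * d \<and> twist (twist Y l) d = T) \<longleftrightarrow>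
        (\<exists>d. 2 ^ N * j + v = m * d \<and> twist Y d = T)"
  proof safe
    fix d assume d: "2 ^ N * (j + k * l) + v = m * d" "twist (twist Y l) d = T"
    \<comment> \<open>The inequality that follows shows that this subtraction is not
      truncated.\<close>
    define c where "c = d - 2 ^ (N - z) * l"
    have "m * (2 ^ (N - z) * l) \<le> m * d"
      using d(1) shift by linarith
    then have d_eq: "d = 2 ^ (N - z) * l + c"
      using m by (simp add: c_def)
    then have c: "2 ^ N * j + v = m * c"
      using d(1) unfolding shift by (simp add: distrib_left)
    then have "c < 2 ^ (N - z)"
      using small m by simp
    then show "\<exists>d. 2 ^ N * j + v = m * d \<and> twist Y d = T"
      using c d(2) by (auto simp: d_eq twist_cancel)
  next
    fix c assume c: "2 ^ N * j + v = m * c" "twist Y c = T"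
    then have "c < 2 ^ (N - z)"
      using small m by simp
    moreover have "2 ^ N * (j + k * l) + v = m * (2 ^ (N - z) * l + c)"
      unfolding shift c(1) by (simp add: distrib_left)
    ultimately show "\<exists>d. 2 ^ N * (j + k * l) + v = m * d \<and> twist (twist Y l) d = T"
      using c(2) twist_cancel by metis
  qed
  then show ?thesis
    by (simp add: accepts_def m_def)
qed

text \<open>Divisibility by \<open>2 ^ N\<close> forces \<open>v = 0\<close>, then divisibility by
  \<open>k\<close> forces \<open>j = 0\<close>. The quotient is \<open>l\<close> without
  \<open>z - N\<close> trailing zeros, hence has the parity of \<open>l\<close>, and the two twists
  cancel.\<close>

lemma accepts_short:
  assumes "0 < k" "j < k" "v < 2 ^ N" "N < z"
  shows "accepts (k * 2 ^ z) (j + k * l) (twist Y l) N v \<longleftrightarrow>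
    v = 0 \<and> j = 0 \<and> Y = T \<and> 2 ^ (z - N) dvd l"
proof
  assume "accepts (k * 2 ^ z) (j + k * l) (twist Y l) N v"
  then obtain d where d: "2 ^ N * (j + k * l) + v = k * 2 ^ z * d" "twist (twist Y l) d = T"
    by (auto simp: accepts_def)
  have z: "(2::nat) ^ z = 2 ^ N * 2 ^ (z - N)"
    using assms(4) by (simp flip: power_add)
  have "2 ^ N dvd 2 ^ N * (j + k * l) + v"
    unfolding d(1) z by simp
  then have "2 ^ N dvd v"
    by (simp add: dvd_add_right_iff)
  then have v: "v = 0"
    using assms(3) by (auto dest: dvd_imp_le)
  have jkl: "j + k * l = k * (2 ^ (z - N) * d)"
    using d(1) unfolding v z by simp
  then have "k dvd j + k * l"
    by simp
  then have j: "j = 0"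
    using assms(2) by (auto simp: dvd_add_left_iff dest: dvd_imp_le)
  then have l: "l = 2 ^ (z - N) * d"
    using jkl assms(1) by simp
  then have "Y = T"
    using d(2) by (simp add: twist_shift)
  then show "v = 0 \<and> j = 0 \<and> Y = T \<and> 2 ^ (z - N) dvd l"
    using v j l by simp
next
  assume *: "v = 0 \<and> j = 0 \<and> Y = T \<and> 2 ^ (z - N) dvd l"
  then obtain d where l: "l = 2 ^ (z - N) * d"
    by auto
  have "2 ^ N * (k * l) = k * (2 ^ N * 2 ^ (z - N)) * d"
    by (simp add: l)
  also have "(2::nat) ^ N * 2 ^ (z - N) = 2 ^ z"
    using assms(4) by (simp flip: power_add)
  finally show "accepts (k * 2 ^ z) (j + k * l) (twist Y l) N v"
    using * by (auto simp: accepts_def l twist_shift intro!: exI[of _ d])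
qed

text \<open>As soon as the multiples of \<open>m\<close> in the interval \<open>[2\<^sup>N j, 2\<^sup>N (j + 1))\<close> have two
  consecutive quotients \<open>2 q\<close>, \<open>2 q + 1\<close>, one of these has the required Thue--Morse parity.\<close>

lemma accepts_nonempty:
  assumes "0 < m" "3 * m < 2 ^ N"
  shows "\<exists>v < 2 ^ N. accepts m j Y N v"
proof -
  \<comment> \<open>\<open>2 * m * q\<close> is the least multiple of \<open>2 * m\<close> strictly
    above \<open>2 ^ N * j\<close>, exceeding it by at most \<open>2 * m\<close>. So
    \<open>m * (2 * q + 1)\<close> exceeds it by at most \<open>3 * m\<close>.\<close>
  define q where "q = 2 ^ N * j div (2 * m) + 1"
  obtain d where d: "d \<in> {2 * q, 2 * q + 1}" "twist Y d = T"
    using twist_both by blast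
  have "2 ^ N * j = 2 * m * (2 ^ N * j div (2 * m)) + 2 ^ N * j mod (2 * m)"
    by simp
  then have q: "2 * m * q = 2 ^ N * j + (2 * m - 2 ^ N * j mod (2 * m))"
    using assms(1) mod_less_divisor[of "2 * m" "2 ^ N * j"]
    unfolding q_def distrib_left by linarith
  have "2 ^ N * j \<le> m * d" "m * d < 2 ^ N * j + 2 ^ N"
    using d(1) q assms(2) by (auto simp: distrib_left mult.commute mult.left_commute)
  then show ?thesis
    using d(2) by (intro exI[of _ "m * d - 2 ^ N * j"]) (auto simp: accepts_def)
qed

text \<open>The value \<open>v\<close> determines \<open>2 ^ N * j\<close> modulo \<open>k\<close>;
  as \<open>k\<close> is odd, \<open>2 ^ N\<close> is invertible there and \<open>j < k\<close> is
  determined. Then so is the quotient, and with it the side.\<close>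

lemma accepts_unique:
  assumes "odd k" "k dvd m" "0 < m" "j < k" "j' < k" "accepts m j Y N v" "accepts m j' Y' N v"
  shows "j = j' \<and> Y = Y'"
proof -
  \<comment> \<open>If \<open>a < b\<close>, then \<open>k\<close> would divide the positive number
    \<open>b - a < k\<close>. Two uses with exchanged roles give equality.\<close>
  have le: "b \<le> a" if "2 ^ N * a + v = m * d" "2 ^ N * b + v = m * c" "b < k" for a b c d
  proof -
    have "k dvd (2 ^ N * b + v) - (2 ^ N * a + v)"
      unfolding that using assms(2) by (simp add: dvd_diff_nat)
    then have "k dvd 2 ^ N * (b - a)"
      by (simp add: diff_mult_distrib2)
    then have "k dvd b - a"
      using assms(1) by (simp add: coprime_dvd_mult_right_iff)
    then show "b \<le> a"
      using that(3) by (auto dest: dvd_imp_le)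
  qed
  obtain d d' where d: "2 ^ N * j + v = m * d" "twist Y d = T"
      and d': "2 ^ N * j' + v = m * d'" "twist Y' d' = T"
    using assms(6,7) by (auto simp: accepts_def)
  have j: "j = j'"
    using le[OF d(1) d'(1) assms(5)] le[OF d'(1) d(1) assms(4)] by simp
  then have "d = d'"
    using d(1) d'(1) assms(3) by simp
  then show ?thesis
    using j d(2) d'(2) twist_inject by metis
qed

lemma add_mult_less:
  assumes "j < k" "l < c"
  shows "j + k * l < k * (c::nat)"
proof -
  have "j + k * l < k * Suc l"
    using assms(1) by simp
  also have "\<dots> \<le> k * c"
    using assms(2) by (intro mult_le_mono2) simp
  finally show ?thesis .
qed

text \<open>Long words detect exactly \<open>(j, Y)\<close>. Short words can only add information
  when \<open>(j, Y) = (0, T)\<close>, through the accepted words \<open>0^n\<close>.\<close>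

lemma lang_from_projected_eq_iff_residues:
  assumes "odd k" "p > 0" "j < k" "l < 2 ^ z" "j' < k" "l' < 2 ^ z"
  shows "lang_from (projected_automaton (k * 2 ^ z) p) (j + k * l, twist Y l) =
      lang_from (projected_automaton (k * 2 ^ z) p) (j' + k * l', twist Y' l') \<longleftrightarrow>
    j = j' \<and> Y = Y' \<and>
      ((j, Y) = (0, T) \<longrightarrow> (\<forall>n. p * n < z \<longrightarrow> 2 ^ (z - p * n) dvd l \<longleftrightarrow> 2 ^ (z - p * n) dvd l'))"
    (is "?L = ?L' \<longleftrightarrow> ?R")
proof -
  define m where "m = k * 2 ^ z"
  have k: "k > 0"
    using assms(1) by (cases k) auto
  then have m: "m > 0" "k dvd m"
    by (simp_all add: m_def)
  have eq_iff: "?L = ?L' \<longleftrightarrow> (\<forall>n v. v < 2 ^ (p * n) \<longrightarrow>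
      accepts m (j + k * l) (twist Y l) (p * n) v \<longleftrightarrow> accepts m (j' + k * l') (twist Y' l') (p * n) v)"
    unfolding m_def
    using lang_from_projected_eq_iff[OF m(1), unfolded m_def] assms add_mult_less by simp
  show ?thesis
  proof
    assume "?L = ?L'"
    then have eq: "accepts m (j + k * l) (twist Y l) (p * n) v \<longleftrightarrow>
        accepts m (j' + k * l') (twist Y' l') (p * n) v" if "v < 2 ^ (p * n)" for n v
      using that eq_iff by blast
    \<comment> \<open>A word of \<open>3 * m\<close> letters is long enough for both
      \<open>accepts_nonempty\<close> and \<open>accepts_long\<close>.\<close>
    have "3 * m < 2 ^ (3 * m)"
      by (rule less_exp)
    also have "(2::nat) ^ (3 * m) \<le> 2 ^ (p * (3 * m))"
      using assms(2) by (intro power_increasing) auto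
    finally obtain v where v: "v < 2 ^ (p * (3 * m))" "accepts m j Y (p * (3 * m)) v"
      using accepts_nonempty m(1) by blast
    have "z < 2 ^ z"
      by (rule less_exp)
    also have "\<dots> \<le> m"
      using k by (simp add: m_def)
    also have "\<dots> \<le> p * (3 * m)"
      using assms(2) by (cases p) auto
    finally have "z \<le> p * (3 * m)"
      by simp
    then have "accepts m j' Y' (p * (3 * m)) v"
      using eq[OF v(1)] v accepts_long[OF k] assms by (simp add: m_def)
    then have jY: "j = j' \<and> Y = Y'"
      using accepts_unique assms(1,3,5) m v(2) by blast
    moreover have "2 ^ (z - p * n) dvd l \<longleftrightarrow> 2 ^ (z - p * n) dvd l'"
      if "(j, Y) = (0, T)" "p * n < z" for n
      using eq[of 0 n] that jY k by (simp add: m_def accepts_short[OF k, of 0, simplified])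
    ultimately show ?R
      by blast
  next
    assume R: ?R
    show "?L = ?L'"
      unfolding eq_iff
    proof (intro allI impI)
      fix n v :: nat assume v: "v < 2 ^ (p * n)"
      show "accepts m (j + k * l) (twist Y l) (p * n) v \<longleftrightarrow>
        accepts m (j' + k * l') (twist Y' l') (p * n) v"
      proof (cases "p * n < z")
        case True
        then show ?thesis
          unfolding m_def accepts_short[OF k assms(3) v True] accepts_short[OF k assms(5) v True]
          using R by auto
      next
        case False
        then have z: "z \<le> p * n"
          by simp
        show ?thesis
          unfolding m_def accepts_long[OF k assms(3) v z] accepts_long[OF k assms(5) v z]
          using R by auto
      qed
    qed
  qed
qed


section \<open>The states of the quotient\<close>

text \<open>The admissible indices are thus the lengths of words with fewer than \<open>z\<close>
  bits, the case of \<open>accepts_short\<close>.\<close>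

lemma less_num_Gamma_iff:
  assumes "p > 0"
  shows "b < num_Gamma z p \<longleftrightarrow> p * b < z"
proof -
  have "b < num_Gamma z p \<longleftrightarrow> real b < real z / real p"
    unfolding num_Gamma_def by (metis less_ceiling_iff of_int_of_nat_eq zless_nat_eq_int_zless)
  also have "\<dots> \<longleftrightarrow> real (p * b) < real z"
    using assms by (simp add: field_simps)
  finally show ?thesis
    by (simp only: of_nat_less_iff)
qed

text \<open>The condition \<open>\<alpha> div p = \<beta>\<close> with \<open>\<alpha> < z\<close>
  covers the full classes and the last one alike. Writing the side as \<open>twist T l\<close>
  exhibits the members as states with \<open>(j, Y) = (0, T)\<close>.\<close>

lemma Gamma_class_altdef:
  assumes "p > 0"
  shows "Gamma_class k z p \<beta> =
    {(k * l, twist T l) | l. \<exists>\<alpha><z. \<exists>c<2 ^ \<alpha>. \<alpha> div p = \<beta> \<and> l = 2 ^ (z - \<alpha> - 1) * (2 * c + 1)}"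
proof -
  have div: "\<alpha> div p = \<beta> \<longleftrightarrow> \<beta> * p \<le> \<alpha> \<and> \<alpha> < \<beta> * p + p" for \<alpha>
    using less_eq_div_iff_mult_less_eq[OF assms, of \<beta> \<alpha>] div_less_iff_less_mult[OF assms, of \<alpha> "Suc \<beta>"]
    by auto
  have index: "Gamma_class k z p \<beta> = (\<Union>\<alpha>\<in>{\<alpha>. \<alpha> < z \<and> \<alpha> div p = \<beta>}. C_class k z \<alpha>)"
  proof (cases "\<beta> + 1 < num_Gamma z p")
    case True
    then have "\<beta> * p + p < z"
      using less_num_Gamma_iff[OF assms, of "\<beta> + 1" z] by (simp add: algebra_simps)
    then have "{\<alpha>. \<alpha> < z \<and> \<alpha> div p = \<beta>} = {\<beta> * p..<\<beta> * p + p}"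
      unfolding div by auto
    then show ?thesis
      using True by (simp add: Gamma_class_def)
  next
    case False
    then have "z \<le> \<beta> * p + p"
      using less_num_Gamma_iff[OF assms, of "\<beta> + 1" z] by (simp add: algebra_simps)
    then have "{\<alpha>. \<alpha> < z \<and> \<alpha> div p = \<beta>} = {\<beta> * p..<z}"
      unfolding div by auto
    then show ?thesis
      using False by (simp add: Gamma_class_def)
  qed
  have C: "C_class k z \<alpha> = {(k * l, twist T l) | l. \<exists>c<2 ^ \<alpha>. l = 2 ^ (z - \<alpha> - 1) * (2 * c + 1)}"
    if "\<alpha> < z" for \<alpha>
  proof -
    have "z - \<alpha> = Suc (z - \<alpha> - 1)"
      using that by simp
    then have "(2::nat) ^ (z - \<alpha>) = 2 ^ (z - \<alpha> - 1) * 2"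
      by (metis power_Suc2)
    then have "k * 2 ^ (z - \<alpha> - 1) + k * 2 ^ (z - \<alpha>) * c = k * (2 ^ (z - \<alpha> - 1) * (2 * c + 1))" for c
      by (simp add: algebra_simps)
    \<comment> \<open>The digit 1 appended to \<open>c\<close> exchanges \<open>B\<close> and
      \<open>T\<close>; the zeros after it change nothing.\<close>
    moreover have "twist B c = twist T (2 ^ (z - \<alpha> - 1) * (2 * c + 1))" for c
      by (simp only: twist_shift twist_T_odd)
    ultimately show ?thesis
      unfolding C_class_def by auto
  qed
  show ?thesis
    unfolding index using C by auto
qed

lemma two_power_dvd_iff: "(2::nat) ^ a dvd 2 ^ b * (2 * c + 1) \<longleftrightarrow> a \<le> b"
  by (subst coprime_dvd_mult_left_iff) (simp_all add: dvd_power_iff_le)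

text \<open>Here \<open>z - \<alpha> - 1\<close> is the 2-adic valuation of \<open>l\<close>;
  cancelling that power of 2 in \<open>l < 2 ^ z\<close> leaves
  \<open>2 * c + 1 < 2 * 2 ^ \<alpha>\<close>.\<close>

lemma dyadic_form:
  assumes "l \<noteq> 0" "l < 2 ^ z"
  shows "\<exists>\<alpha><z. \<exists>c<2 ^ \<alpha>. l = 2 ^ (z - \<alpha> - 1) * (2 * c + 1 :: nat)"
proof -
  obtain b where "l = 2 ^ multiplicity 2 l * b" "odd b"
    using multiplicity_decompose'[of l 2] assms(1) by auto
  then obtain e c where l: "l = 2 ^ e * (2 * c + 1)"
    by (metis oddE)
  have "(2::nat) ^ e \<le> l"
    by (simp add: l)
  also have "\<dots> < 2 ^ z"
    by (rule assms(2))
  finally have "e < z"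
    by simp
  define \<alpha> where "\<alpha> = z - 1 - e"
  have z: "z = e + Suc \<alpha>"
    using \<open>e < z\<close> by (simp add: \<alpha>_def)
  then have "c < 2 ^ \<alpha>"
    using assms(2) mult_less_cancel1[of "2 ^ e" "2 * c + 1" "2 * 2 ^ \<alpha>"]
    by (simp add: l power_add mult.left_commute)
  then show ?thesis
    using l z by (intro exI[of _ \<alpha>] conjI exI[of _ c]) auto
qed

text \<open>The dyadic index \<open>\<alpha>\<close> of \<open>l = 2\<^bsup>z-\<alpha>-1\<^esup> (2 c + 1)\<close>, and thereby the class \<open>\<Gamma>\<^sub>\<beta>\<close>, can be
  read off from the words \<open>0\<^sup>n\<close> with \<open>p n < z\<close> that are accepted.\<close>

lemma Gamma_class_zeros:
  assumes "p > 0" "\<beta> < num_Gamma z p"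
  shows "Gamma_class k z p \<beta> =
    {(k * l, twist T l) | l. l < 2 ^ z \<and> (\<forall>n. p * n < z \<longrightarrow> 2 ^ (z - p * n) dvd l \<longleftrightarrow> \<beta> < n)}"
proof -
  have "(\<exists>\<alpha><z. \<exists>c<2 ^ \<alpha>. \<alpha> div p = \<beta> \<and> l = 2 ^ (z - \<alpha> - 1) * (2 * c + 1)) \<longleftrightarrow>
      l < 2 ^ z \<and> (\<forall>n. p * n < z \<longrightarrow> 2 ^ (z - p * n) dvd l \<longleftrightarrow> \<beta> < n)" (is "?L \<longleftrightarrow> ?R") for l :: nat
  proof
    assume ?L
    then obtain \<alpha> c where \<alpha>: "\<alpha> < z" "c < 2 ^ \<alpha>" "\<alpha> div p = \<beta>" "l = 2 ^ (z - \<alpha> - 1) * (2 * c + 1)"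
      by blast
    have "l < 2 ^ (z - \<alpha> - 1) * 2 ^ Suc \<alpha>"
      unfolding \<alpha>(4) using \<alpha>(2) by (intro mult_strict_left_mono) auto
    also have "\<dots> = 2 ^ z"
      using \<alpha>(1) by (simp only: power_add[symmetric]) simp
    finally have "l < 2 ^ z" .
    moreover have "2 ^ (z - p * n) dvd l \<longleftrightarrow> \<beta> < n" if "p * n < z" for n
    proof -
      have "2 ^ (z - p * n) dvd l \<longleftrightarrow> \<alpha> < p * n"
        unfolding \<alpha>(4) two_power_dvd_iff using that \<alpha>(1) by auto
      also have "\<dots> \<longleftrightarrow> \<beta> < n"
        unfolding \<alpha>(3)[symmetric] div_less_iff_less_mult[OF assms(1)] by (simp add: mult.commute)
      finally show ?thesis .
    qed
    ultimately show ?R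
      by blast
  next
    assume R: ?R
    have \<beta>: "p * \<beta> < z"
      using assms less_num_Gamma_iff by blast
    then have "\<not> 2 ^ (z - p * \<beta>) dvd l"
      using R by blast
    then have "l \<noteq> 0"
      by (metis dvd_0_right)
    then obtain \<alpha> c where \<alpha>: "\<alpha> < z" "c < 2 ^ \<alpha>" and l: "l = 2 ^ (z - \<alpha> - 1) * (2 * c + 1)"
      using dyadic_form R by blast
    have "p * \<beta> \<le> \<alpha>"
      using \<open>\<not> 2 ^ (z - p * \<beta>) dvd l\<close> \<alpha>(1) unfolding l two_power_dvd_iff by simp
    \<comment> \<open>The upper bound comes from \<open>n = Suc \<beta>\<close> when that word is
      short; otherwise \<open>\<alpha> < z\<close> already implies it.\<close>
    moreover have "\<alpha> < p * Suc \<beta>"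
    proof (cases "p * Suc \<beta> < z")
      case True
      then have "2 ^ (z - p * Suc \<beta>) dvd l"
        using R by blast
      then show ?thesis
        unfolding l two_power_dvd_iff using True by simp
    qed (use \<alpha>(1) in simp)
    ultimately have "\<alpha> div p = \<beta>"
      by (simp add: div_nat_eqI mult.commute)
    then show ?L
      using \<alpha> l by blast
  qed
  then show ?thesis
    unfolding Gamma_class_altdef[OF assms(1)] by simp
qed

section \<open>A common form for all classes\<close>

text \<open>\<open>D n\<close> records whether \<open>0^n\<close> is accepted. It is consulted only
  for \<open>(j, Y) = (0, T)\<close> and \<open>p * n < z\<close>, matching
  \<open>lang_from_projected_eq_iff_residues\<close>.\<close>

definition block :: "nat \<Rightarrow> nat \<Rightarrow> nat \<Rightarrow> nat \<Rightarrow> side \<Rightarrow> (nat \<Rightarrow> bool) \<Rightarrow> (nat \<times> side) set" where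
  "block k z p j Y D = {(j + k * l, twist Y l) | l. l < 2 ^ z \<and>
     ((j, Y) = (0, T) \<longrightarrow> (\<forall>n. p * n < z \<longrightarrow> 2 ^ (z - p * n) dvd l \<longleftrightarrow> D n))}"

lemma pair_class_block: "(j, Y) \<noteq> (0, T) \<Longrightarrow> pair_class k z (j, Y) = block k z p j Y D"
  by (auto simp: pair_class_def block_def)

lemma pair_class_0_T: "pair_class k z (0, T) = {(0, T)}"
  by (simp add: pair_class_def)

text \<open>The case \<open>n = 0\<close> requires \<open>2 ^ z\<close> to divide
  \<open>l < 2 ^ z\<close>; if \<open>z = 0\<close>, the range alone leaves
  \<open>l = 0\<close>.\<close>

lemma singleton_block: "{(0, T)} = block k z p 0 T (\<lambda>_. True)"
proof -
  have "l < 2 ^ z \<and> (\<forall>n. p * n < z \<longrightarrow> 2 ^ (z - p * n) dvd l) \<longleftrightarrow> l = 0" for l :: nat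
  proof
    assume l: "l < 2 ^ z \<and> (\<forall>n. p * n < z \<longrightarrow> 2 ^ (z - p * n) dvd l)"
    then have "2 ^ z dvd l"
      by (cases "z = 0") (auto dest: spec[of _ 0])
    then show "l = 0"
      using l by (auto dest: dvd_imp_le)
  qed auto
  then show ?thesis
    by (simp add: block_def)
qed

lemma Gamma_class_block:
  "p > 0 \<Longrightarrow> \<beta> < num_Gamma z p \<Longrightarrow> Gamma_class k z p \<beta> = block k z p 0 T (\<lambda>n. \<beta> < n)"
  by (simp add: Gamma_class_zeros block_def)

lemma Gamma_class_nonempty:
  assumes "p > 0" "\<beta> < num_Gamma z p"
  shows "Gamma_class k z p \<beta> \<noteq> {}"
proof -
  \<comment> \<open>The witnesses are \<open>\<alpha> = p * \<beta>\<close> and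
    \<open>c = 0\<close>.\<close>
  have "p * \<beta> < z" "p * \<beta> div p = \<beta>" "(0::nat) < 2 ^ (p * \<beta>)"
    using assms less_num_Gamma_iff by auto
  then show ?thesis
    unfolding Gamma_class_altdef[OF assms(1)] by blast
qed

lemma mem_M_states_iff:
  "J \<in> M_states m p \<longleftrightarrow> (\<exists>j<odd_part m. \<exists>Y. J = pair_class (odd_part m) (two_exp m) (j, Y)) \<or>
     (\<exists>\<beta><num_Gamma (two_exp m) p. J = Gamma_class (odd_part m) (two_exp m) p \<beta>)"
  by (auto simp: M_states_def Let_def image_iff)

lemma pair_class_in_M_states:
  "j < odd_part m \<Longrightarrow> pair_class (odd_part m) (two_exp m) (j, Y) \<in> M_states m p"
  by (simp add: M_states_def Let_def)

lemma Gamma_class_in_M_states: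
  "\<beta> < num_Gamma (two_exp m) p \<Longrightarrow> Gamma_class (odd_part m) (two_exp m) p \<beta> \<in> M_states m p"
  by (simp add: M_states_def Let_def)

lemma M_states_block:
  assumes "p > 0" "m > 0" "J \<in> M_states m p"
  shows "\<exists>j<odd_part m. \<exists>Y D. J = block (odd_part m) (two_exp m) p j Y D"
proof -
  have "odd_part m > 0"
    using odd_odd_part[OF assms(2)] by (cases "odd_part m") auto
  then show ?thesis
    using assms(3) pair_class_block pair_class_0_T singleton_block Gamma_class_block[OF assms(1)]
    unfolding mem_M_states_iff by metis
qed

lemma empty_notin_M_states:
  assumes "p > 0"
  shows "{} \<notin> M_states m p"
proof -
  have "pair_class k z (j, Y) \<noteq> {}" for k z j Y
    by (auto simp: pair_class_def intro!: exI[of _ 0])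
  then show ?thesis
    using Gamma_class_nonempty[OF assms] unfolding mem_M_states_iff by metis
qed

lemma block_subset: "j < k \<Longrightarrow> block k z p j Y D \<subseteq> {0..<k * 2 ^ z} \<times> UNIV"
  using add_mult_less by (auto simp: block_def)

lemma ex_M_state:
  assumes "p > 0" "i < m"
  shows "\<exists>J\<in>M_states m p. (i, X) \<in> J"
proof -
  define k z where "k = odd_part m" and "z = two_exp m"
  have m: "m = k * 2 ^ z"
    unfolding k_def z_def by (rule odd_part_two_exp)
  define j l where "j = i mod k" and "l = i div k"
  \<comment> \<open>Twisting by \<open>l\<close> is an involution, so this is the side whose twist
    by \<open>l\<close> is \<open>X\<close>.\<close>
  define Y where "Y = twist X l"
  have k: "k > 0"
    using assms(2) m by (cases k) auto
  have i: "i = j + k * l" and j: "j < k" and l: "l < 2 ^ z"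
    using assms(2) m k by (simp_all add: j_def l_def less_mult_imp_div_less mult.commute)
  have X: "X = twist Y l"
    by (simp add: Y_def)
  consider "(j, Y) \<noteq> (0, T)" | "(j, Y) = (0, T)" "l = 0" | "(j, Y) = (0, T)" "l \<noteq> 0"
    by blast
  then show ?thesis
  proof cases
    case 1
    then have "(i, X) \<in> pair_class k z (j, Y)"
      using l i X by (auto simp: pair_class_def)
    then show ?thesis
      using pair_class_in_M_states[OF j[unfolded k_def]] unfolding k_def z_def by (rule bexI)
  next
    case 2
    then have "(i, X) \<in> pair_class k z (0, T)"
      using i X by (simp add: pair_class_def)
    then show ?thesis
      using pair_class_in_M_states[OF k[unfolded k_def]] unfolding k_def z_def by (rule bexI)
  next
    case 3
    then obtain \<alpha> c where \<alpha>: "\<alpha> < z" "c < 2 ^ \<alpha>" "l = 2 ^ (z - \<alpha> - 1) * (2 * c + 1)"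
      using dyadic_form l by blast
    moreover have "i = k * l" "X = twist T l"
      using i X 3 by simp_all
    ultimately have "(i, X) \<in> Gamma_class k z p (\<alpha> div p)"
      unfolding Gamma_class_altdef[OF assms(1)] by blast
    moreover have \<beta>: "\<alpha> div p < num_Gamma z p"
      using less_num_Gamma_iff[OF assms(1)] \<alpha>(1) by (meson le_less_trans times_div_less_eq_dividend)
    ultimately show ?thesis
      using Gamma_class_in_M_states[OF \<beta>[unfolded z_def]] unfolding k_def z_def by (intro bexI)
  qed
qed

lemma M_states_nerode:
  assumes "p > 0" "m > 0" "J \<in> M_states m p" "J' \<in> M_states m p" "q \<in> J" "r \<in> J'"
  shows "J = J' \<longleftrightarrow>
    lang_from (projected_automaton m p) q = lang_from (projected_automaton m p) r"
proof -
  define k z where "k = odd_part m" and "z = two_exp m"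
  have m: "m = k * 2 ^ z"
    unfolding k_def z_def by (rule odd_part_two_exp)
  have k: "odd k"
    unfolding k_def using assms(2) by (rule odd_odd_part)
  obtain j Y D where j: "j < k" and J: "J = block k z p j Y D"
    using M_states_block[OF assms(1,2,3)] unfolding k_def z_def by blast
  obtain j' Y' D' where j': "j' < k" and J': "J' = block k z p j' Y' D'"
    using M_states_block[OF assms(1,2,4)] unfolding k_def z_def by blast
  \<comment> \<open>The parameters stay general because a class does not determine its
    \<open>D\<close>: for \<open>J = J'\<close> both states are placed in the same block.\<close>
  have eq: "lang_from (projected_automaton m p) q = lang_from (projected_automaton m p) r \<longleftrightarrow>
      j = j' \<and> Y = Y' \<and> ((j, Y) = (0, T) \<longrightarrow> (\<forall>n. p * n < z \<longrightarrow> D n \<longleftrightarrow> E n))"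
    if q: "q \<in> block k z p j Y D" and r: "r \<in> block k z p j' Y' E" and j: "j < k" "j' < k" for q r j j' Y Y' D E
  proof -
    obtain l where l: "q = (j + k * l, twist Y l)" "l < 2 ^ z"
        "(j, Y) = (0, T) \<longrightarrow> (\<forall>n. p * n < z \<longrightarrow> 2 ^ (z - p * n) dvd l \<longleftrightarrow> D n)"
      using q unfolding block_def by blast
    obtain l' where l': "r = (j' + k * l', twist Y' l')" "l' < 2 ^ z"
        "(j', Y') = (0, T) \<longrightarrow> (\<forall>n. p * n < z \<longrightarrow> 2 ^ (z - p * n) dvd l' \<longleftrightarrow> E n)"
      using r unfolding block_def by blast
    show ?thesis
      unfolding l(1) l'(1) m
        lang_from_projected_eq_iff_residues[OF k assms(1) j(1) l(2) j(2) l'(2)]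
      using l(3) l'(3) by blast
  qed
  show ?thesis
  proof
    assume "J = J'"
    then show "lang_from (projected_automaton m p) q = lang_from (projected_automaton m p) r"
      using eq[of q j Y D r j Y D] assms(5,6) j J by blast
  next
    assume "lang_from (projected_automaton m p) q = lang_from (projected_automaton m p) r"
    then have "j = j' \<and> Y = Y' \<and> ((j, Y) = (0, T) \<longrightarrow> (\<forall>n. p * n < z \<longrightarrow> D n \<longleftrightarrow> D' n))"
      using eq assms(5,6) j j' J J' by blast
    \<comment> \<open>\<open>D\<close> and \<open>D'\<close> agree wherever \<open>block\<close>
      consults them.\<close>
    then show "J = J'"
      unfolding J J' block_def by auto
  qed
qed

theorem theorem33:
  fixes p m :: nat
  assumes "p > 0" and "m > 0"
  shows "is_minimal_automaton (digits p) (val_inv p ((*) m ` thue_morse)) (M_automaton m p)"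
proof -
  let ?A = "projected_automaton m p"
  have "odd_part m > 0"
    using odd_odd_part[OF assms(2)] by (cases "odd_part m") auto
  then have init: "{(0, T)} \<in> M_states m p"
    using pair_class_in_M_states[of 0 m T p] by (simp add: pair_class_0_T)
  have "J \<subseteq> {0..<m} \<times> UNIV" if "J \<in> M_states m p" for J
    using M_states_block[OF assms that] block_subset odd_part_two_exp[of m] by metis
  moreover have "q \<in> \<Union>(M_states m p)" if "q \<in> {0..<m} \<times> UNIV" for q
    using that ex_M_state[OF assms(1)] by fastforce
  ultimately have cover: "\<Union>(M_states m p) = states ?A"
    unfolding states_projected by blast
  \<comment> \<open>The Nerode property with \<open>(0, T)\<close> on both sides leaves one class
    containing the final state.\<close>
  have "J = {(0, T)}" if "J \<in> M_states m p" "(0, T) \<in> J" for J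
    using M_states_nerode[OF assms that(1) init that(2)] by simp
  then have finals: "{{(0, T)}} = {J \<in> M_states m p. J \<inter> {(0, T)} \<noteq> {}}"
    using init by blast
  have "is_minimal_automaton (alphabet ?A) (language ?A) (M_automaton m p)"
    by (rule quotient_is_minimal[where \<P> = "M_states m p"])
      (use assms init cover finals M_states_nerode[OF assms] in
        \<open>simp_all add: M_automaton_def Let_def pair_class_0_T wf_projected deterministic_projected
          complete_projected accessible_projected empty_notin_M_states\<close>)
  then show ?thesis
    using assms by (simp add: language_projected)
qed

end
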